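(* Let $(X,d)$ be a metric space, let $\le$ be a quasi-order (reflexive and transitive relation) on $X$, and let $T:X\to X$ be a map such that $X(T,\le):=\{x\in X: x\le Tx\}$ is nonempty and $T$ is increasing ($x\le y$ implies $Tx\le Ty$). Assume that $d$ is $(\le)$-complete and that there is $\alpha\in\,]0,1[$ such that $$d(Tx,Ty)\le \alpha\, d(x,y)\quad\text{for all } x,y\in X \text{ with } x\le y.$$ Assume in addition that either $T$ is $(d,\le)$-continuous or $(\le)$ is $d$-self-closed. Then $T$ is a Picard operator (modulo $(d,\le)$). Moreover, if, in addition to the assumptions that $X(T,\le)$ is nonempty, that $T$ is increasing, that $d$ is $(\le)$-complete, that $d(Tx,Ty)\le\alpha\, d(x,y)$ whenever $x\le y$ (with $\alpha\in\,]0,1[$), and that either $T$ is $(d,\le)$-continuous or $(\le)$ is $d$-self-closed, for each $x,y\in X$ there exists a $<>$-chain between $x$ and $y$, then $T$ is a strong Picard operator (modulo $(d,\le)$).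
   Context: A sequence $(x_n)_{n\ge 0}$ in $X$ is ascending if $x_n\le x_m$ whenever $n\le m$. An element $u$ is an upper bound of $(x_n)$ if $x_n\le u$ for all $n$. $d$ is $(\le)$-complete if each ascending $d$-Cauchy sequence is $d$-convergent (in $X$). $T$ is $(d,\le)$-continuous if, whenever $(x_n)$ is ascending and $x_n\to x$ in $d$, one has $Tx_n\to Tx$ in $d$. $(\le)$ is $d$-self-closed if the $d$-limit of each ($d$-convergent) ascending sequence is an upper bound of that sequence. For $x,y\in X$ write $x<>y$ if $x\le y$ or $y\le x$. A $<>$-chain between $x$ and $y$ is a finite family $z_1,\dots,z_k$ ($k\ge 2$) in $X$ with $z_1=x$, $z_k=y$ and $z_i<>z_{i+1}$ for all $i\in\{1,\dots,k-1\}$. $\mathrm{fix}(T)=\{z\in X: z=Tz\}$. $T$ is a Picard operator (modulo $(d,\le)$) if for each $x\in X(T,\le)$ the sequence $(T^nx)_{n\ge0}$ is $d$-convergent and its limit belongs to $\mathrm{fix}(T)$. $T$ is a strong Picard operator (modulo $(d,\le)$) if for each $x\in X$ the sequence $(T^nx)_{n\ge0}$ is $d$-convergent and its limit belongs to $\mathrm{fix}(T)$, and moreover $\mathrm{fix}(T)$ is a singleton. *)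

theory Defs
  imports "HOL-Analysis.Analysis"
begin

context Metric_space
begin

definition ascending :: "('a \<Rightarrow> 'a \<Rightarrow> bool) \<Rightarrow> (nat \<Rightarrow> 'a) \<Rightarrow> bool" where
  "ascending le x \<longleftrightarrow> range x \<subseteq> M \<and> (\<forall>n m. n \<le> m \<longrightarrow> le (x n) (x m))"

definition upper_bound :: "('a \<Rightarrow> 'a \<Rightarrow> bool) \<Rightarrow> (nat \<Rightarrow> 'a) \<Rightarrow> 'a \<Rightarrow> bool" where
  "upper_bound le x u \<longleftrightarrow> u \<in> M \<and> (\<forall>n. le (x n) u)"

definition order_complete :: "('a \<Rightarrow> 'a \<Rightarrow> bool) \<Rightarrow> bool" where
  "order_complete le \<longleftrightarrow>
     (\<forall>x. ascending le x \<and> MCauchy x \<longrightarrow> (\<exists>l. limitin mtopology x l sequentially))"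

definition order_continuous :: "('a \<Rightarrow> 'a \<Rightarrow> bool) \<Rightarrow> ('a \<Rightarrow> 'a) \<Rightarrow> bool" where
  "order_continuous le T \<longleftrightarrow>
     (\<forall>x l. ascending le x \<and> limitin mtopology x l sequentially \<longrightarrow>
        limitin mtopology (\<lambda>n. T (x n)) (T l) sequentially)"

definition self_closed :: "('a \<Rightarrow> 'a \<Rightarrow> bool) \<Rightarrow> bool" where
  "self_closed le \<longleftrightarrow>
     (\<forall>x l. ascending le x \<and> limitin mtopology x l sequentially \<longrightarrow> upper_bound le x l)"

definition progressive_points :: "('a \<Rightarrow> 'a \<Rightarrow> bool) \<Rightarrow> ('a \<Rightarrow> 'a) \<Rightarrow> 'a set" where
  "progressive_points le T = {x \<in> M. le x (T x)}"

definition fixed_points :: "('a \<Rightarrow> 'a) \<Rightarrow> 'a set" where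
  "fixed_points T = {z \<in> M. z = T z}"

definition comparable_chain :: "('a \<Rightarrow> 'a \<Rightarrow> bool) \<Rightarrow> 'a \<Rightarrow> 'a \<Rightarrow> 'a list \<Rightarrow> bool" where
  "comparable_chain le x y zs \<longleftrightarrow>
     2 \<le> length zs \<and> set zs \<subseteq> M \<and> hd zs = x \<and> last zs = y \<and>
     (\<forall>i. Suc i < length zs \<longrightarrow> le (zs ! i) (zs ! Suc i) \<or> le (zs ! Suc i) (zs ! i))"

definition picard_operator :: "('a \<Rightarrow> 'a \<Rightarrow> bool) \<Rightarrow> ('a \<Rightarrow> 'a) \<Rightarrow> bool" where
  "picard_operator le T \<longleftrightarrow>
     (\<forall>x \<in> progressive_points le T.
        \<exists>l \<in> fixed_points T. limitin mtopology (\<lambda>n. (T ^^ n) x) l sequentially)"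

text \<open>The strong notion does not involve the order, hence no parameter \<open>le\<close>.\<close>

definition strong_picard_operator :: "('a \<Rightarrow> 'a) \<Rightarrow> bool" where
  "strong_picard_operator T \<longleftrightarrow>
     (\<forall>x \<in> M. \<exists>l \<in> fixed_points T. limitin mtopology (\<lambda>n. (T ^^ n) x) l sequentially) \<and>
     is_singleton (fixed_points T)"

end

end

theory Submission
  imports Defs
begin

text \<open>
  Along the orbit of a progressive point all iterates are comparable, so the contraction
  inequality applies there as in Banach's theorem: the orbit is ascending and Cauchy, and either
  alternative hypothesis makes \<open>T\<close> commute with its limit. Iterates of two comparable
  points approach each other geometrically; by the triangle inequality the same holds for
  two points joined by a chain of comparable points, so every orbit is attracted by the same
  fixed point.
\<close>

locale order_contraction = Metric_space M d
  for M :: "'a set" and d :: "'a \<Rightarrow> 'a \<Rightarrow> real" +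
  fixes le :: "'a \<Rightarrow> 'a \<Rightarrow> bool" and T :: "'a \<Rightarrow> 'a" and \<alpha> :: real
  assumes reflp: "reflp_on M le" and transp: "transp_on M le"
    and maps: "T \<in> M \<rightarrow> M"
    and increasing: "monotone_on M le le T"
    and factor_pos: "0 < \<alpha>" and factor_less_one: "\<alpha> < 1"
    and contraction: "\<And>x y. x \<in> M \<Longrightarrow> y \<in> M \<Longrightarrow> le x y \<Longrightarrow> d (T x) (T y) \<le> \<alpha> * d x y"
begin

text \<open>An upper estimate suffices for the squeeze because \<open>d\<close> is nonnegative on
  the whole type.\<close>

lemma dist_null_comparison:
  assumes "g \<longlonglongrightarrow> 0" and "\<And>n. d (u n) (v n) \<le> g n"
  shows "(\<lambda>n. d (u n) (v n)) \<longlonglongrightarrow> 0"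
  using assms by (intro Lim_null_comparison[OF always_eventually assms(1)]) simp

lemma funpow_closed: "x \<in> M \<Longrightarrow> (T ^^ n) x \<in> M"
  using maps by (induction n) auto

lemma funpow_increasing:
  assumes "x \<in> M" "y \<in> M" "le x y"
  shows "le ((T ^^ n) x) ((T ^^ n) y)"
proof (induction n)
  case (Suc n)
  with monotone_onD[OF increasing] assms funpow_closed show ?case by simp
qed (use assms in simp)

lemma funpow_contraction:
  assumes "x \<in> M" "y \<in> M" "le x y"
  shows "d ((T ^^ n) x) ((T ^^ n) y) \<le> \<alpha> ^ n * d x y"
proof (induction n)
  case (Suc n)
  have "d ((T ^^ Suc n) x) ((T ^^ Suc n) y) \<le> \<alpha> * d ((T ^^ n) x) ((T ^^ n) y)"
    using contraction funpow_closed funpow_increasing assms by simp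
  also have "\<dots> \<le> \<alpha> * (\<alpha> ^ n * d x y)"
    using Suc factor_pos by (intro mult_left_mono) auto
  finally show ?case by (simp add: mult.assoc)
qed simp

text \<open>Applying \<open>T ^^ n\<close> to \<open>le x (T x)\<close> makes consecutive iterates
  comparable, and transitivity then links them all back to \<open>x\<close>.\<close>

lemma progressive_le_funpow:
  assumes "x \<in> progressive_points le T"
  shows "le x ((T ^^ n) x)"
proof (induction n)
  case 0
  show ?case using assms reflp by (auto simp: progressive_points_def reflp_on_def)
next
  case (Suc n)
  have x: "x \<in> M" "le x (T x)" using assms by (auto simp: progressive_points_def)
  then have "le ((T ^^ n) x) ((T ^^ Suc n) x)"
    using funpow_increasing[of x "T x" n] maps by (auto simp: funpow_swap1)
  with Suc show ?case
    using transp_onD[OF transp] funpow_closed x by blast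
qed

lemma progressive_orbit_ascending:
  assumes "x \<in> progressive_points le T"
  shows "ascending le (\<lambda>n. (T ^^ n) x)"
  unfolding ascending_def
proof (intro conjI allI impI)
  have x: "x \<in> M" using assms by (simp add: progressive_points_def)
  then show "range (\<lambda>n. (T ^^ n) x) \<subseteq> M" using funpow_closed by auto
  fix n m :: nat assume "n \<le> m"
  \<comment> \<open>Splitting off the first \<open>n\<close> applications reduces the claim to the
    image under \<open>T ^^ n\<close> of the pair \<open>x\<close>,
    \<open>(T ^^ (m - n)) x\<close>.\<close>
  then have "(T ^^ m) x = (T ^^ n) ((T ^^ (m - n)) x)"
    by (metis comp_apply funpow_add le_add_diff_inverse)
  then show "le ((T ^^ n) x) ((T ^^ m) x)"
    using funpow_increasing progressive_le_funpow assms x funpow_closed by simp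
qed

text \<open>The bound is the fixed point of the map sending t to \<open>d x (T x)\<close> + \<alpha>
  t. This is why the induction closes without summing a geometric series.\<close>

lemma progressive_orbit_bounded:
  assumes "x \<in> progressive_points le T"
  shows "d x ((T ^^ k) x) \<le> d x (T x) / (1 - \<alpha>)"
proof (induction k)
  case 0
  have "x \<in> M" using assms by (simp add: progressive_points_def)
  then show ?case using factor_less_one by simp
next
  case (Suc k)
  have x: "x \<in> M" using assms by (simp add: progressive_points_def)
  then have in_M: "T x \<in> M" "(T ^^ k) x \<in> M" "(T ^^ Suc k) x \<in> M"
    using maps funpow_closed[of x] by auto
  have "d x ((T ^^ Suc k) x) \<le> d x (T x) + d (T x) ((T ^^ Suc k) x)"
    using triangle x in_M by blast
  \<comment> \<open>One common application of \<open>T\<close> is stripped off both points; the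
    remaining pair \<open>x\<close>, \<open>(T ^^ k) x\<close> is comparable because
    \<open>x\<close> is progressive.\<close>
  also have "d (T x) ((T ^^ Suc k) x) \<le> \<alpha> * d x ((T ^^ k) x)"
    using contraction x in_M progressive_le_funpow[OF assms] by simp
  also have "\<dots> \<le> \<alpha> * (d x (T x) / (1 - \<alpha>))"
    using Suc factor_pos by (intro mult_left_mono) auto
  also have "d x (T x) + \<alpha> * (d x (T x) / (1 - \<alpha>)) = d x (T x) / (1 - \<alpha>)"
    using factor_less_one by (simp add: field_simps)
  finally show ?case by simp
qed

text \<open>For n \<le> m the two iterates are images under \<open>T ^^ n\<close> of
  \<open>x\<close> and a later iterate. These are comparable and at distance at most
  \<open>B\<close>, so their images are within \<alpha>^n \<open>B\<close>.\<close>

lemma progressive_orbit_MCauchy: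
  assumes "x \<in> progressive_points le T"
  shows "MCauchy (\<lambda>n. (T ^^ n) x)"
  unfolding MCauchy_def
proof (intro conjI allI impI)
  have x: "x \<in> M" using assms by (simp add: progressive_points_def)
  then show "range (\<lambda>n. (T ^^ n) x) \<subseteq> M" using funpow_closed by auto
  define B where "B = d x (T x) / (1 - \<alpha>)"
  have bound: "d ((T ^^ n) x) ((T ^^ m) x) \<le> \<alpha> ^ n * B" if "n \<le> m" for n m
  proof -
    have "(T ^^ m) x = (T ^^ n) ((T ^^ (m - n)) x)"
      using that by (metis comp_apply funpow_add le_add_diff_inverse)
    then have "d ((T ^^ n) x) ((T ^^ m) x) \<le> \<alpha> ^ n * d x ((T ^^ (m - n)) x)"
      using funpow_contraction x funpow_closed progressive_le_funpow[OF assms] by simp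
    also have "\<dots> \<le> \<alpha> ^ n * B"
      unfolding B_def using progressive_orbit_bounded[OF assms] factor_pos
      by (intro mult_left_mono) auto
    finally show ?thesis .
  qed
  fix \<epsilon> :: real assume "\<epsilon> > 0"
  have "(\<lambda>n. \<alpha> ^ n * B) \<longlonglongrightarrow> 0"
    using factor_pos factor_less_one by (intro tendsto_mult_left_zero LIMSEQ_realpow_zero) auto
  from order_tendstoD(2)[OF this \<open>\<epsilon> > 0\<close>]
  obtain N where N: "\<And>n. n \<ge> N \<Longrightarrow> \<alpha> ^ n * B < \<epsilon>"
    unfolding eventually_sequentially by blast
  \<comment> \<open>Symmetry of \<open>d\<close> lets the smaller of the two indices play the role
    of \<open>n\<close> in \<open>bound\<close>.\<close>
  have "d ((T ^^ n) x) ((T ^^ m) x) < \<epsilon>" if "N \<le> n" "N \<le> m" for n m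
    using that bound[of n m] bound[of m n] N commute
    by (metis linorder_le_cases order_le_less_trans)
  then show "\<exists>N. \<forall>n n'. N \<le> n \<longrightarrow> N \<le> n' \<longrightarrow> d ((T ^^ n) x) ((T ^^ n') x) < \<epsilon>"
    by blast
qed

text \<open>This reduces the second alternative to the first: the limit is an upper bound, hence
  comparable with every term, so the contraction inequality applies to each pair \<open>x n\<close>,
  \<open>l\<close>.\<close>

lemma self_closed_imp_order_continuous:
  assumes "self_closed le"
  shows "order_continuous le T"
  unfolding order_continuous_def
proof (intro allI impI, elim conjE)
  fix x l
  assume asc: "ascending le x" and lim: "limitin mtopology x l sequentially"
  then have l: "l \<in> M" and x: "\<And>n. x n \<in> M" and le: "\<And>n. le (x n) l"
    and null: "(\<lambda>n. d (x n) l) \<longlonglongrightarrow> 0"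
    using assms by (auto simp: self_closed_def upper_bound_def ascending_def limitin_metric_dist_null)
  have "(\<lambda>n. \<alpha> * d (x n) l) \<longlonglongrightarrow> 0"
    using null by (rule tendsto_mult_right_zero)
  moreover have "d (T (x n)) (T l) \<le> \<alpha> * d (x n) l" for n
    using contraction x l le by blast
  ultimately have "(\<lambda>n. d (T (x n)) (T l)) \<longlonglongrightarrow> 0"
    by (rule dist_null_comparison)
  then show "limitin mtopology (\<lambda>n. T (x n)) (T l) sequentially"
    using maps l x by (auto simp: limitin_metric_dist_null intro!: always_eventually)
qed

lemma picard:
  assumes "order_complete le" and cont: "order_continuous le T"
  shows "picard_operator le T"
  unfolding picard_operator_def
proof
  fix x assume x: "x \<in> progressive_points le T"
  note asc = progressive_orbit_ascending[OF x]
  obtain l where lim: "limitin mtopology (\<lambda>n. (T ^^ n) x) l sequentially"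
    using assms(1) asc progressive_orbit_MCauchy[OF x] unfolding order_complete_def by blast
  \<comment> \<open>The shifted orbit is the image of the orbit under \<open>T\<close> and also a
    tail of it, so it tends both to \<open>T l\<close> and to \<open>l\<close>.\<close>
  have "limitin mtopology (\<lambda>n. (T ^^ Suc n) x) (T l) sequentially"
    using cont asc lim unfolding order_continuous_def by simp
  moreover have "limitin mtopology (\<lambda>n. (T ^^ Suc n) x) l sequentially"
    using limitin_sequentially_offset[OF lim, of 1] by simp
  ultimately have "T l = l"
    using limitin_metric_unique trivial_limit_sequentially by blast
  then have "l \<in> fixed_points T"
    using limitin_mspace[OF lim] by (simp add: fixed_points_def)
  with lim show "\<exists>l\<in>fixed_points T. limitin mtopology (\<lambda>n. (T ^^ n) x) l sequentially"
    by blast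
qed

lemma comparable_orbits_asymptotic:
  assumes "x \<in> M" "y \<in> M" "le x y \<or> le y x"
  shows "(\<lambda>n. d ((T ^^ n) x) ((T ^^ n) y)) \<longlonglongrightarrow> 0"
proof -
  have "(\<lambda>n. \<alpha> ^ n * d x y) \<longlonglongrightarrow> 0"
    using factor_pos factor_less_one by (intro tendsto_mult_left_zero LIMSEQ_realpow_zero) auto
  moreover have "d ((T ^^ n) x) ((T ^^ n) y) \<le> \<alpha> ^ n * d x y" for n
    using assms funpow_contraction commute by metis
  ultimately show ?thesis
    by (rule dist_null_comparison)
qed

lemma chain_orbits_asymptotic:
  assumes "comparable_chain le x y zs"
  shows "(\<lambda>n. d ((T ^^ n) x) ((T ^^ n) y)) \<longlonglongrightarrow> 0"
proof -
  have zs: "zs \<noteq> []" "hd zs = x" "last zs = y" "set zs \<subseteq> M"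
    and comp: "\<And>i. Suc i < length zs \<Longrightarrow> le (zs ! i) (zs ! Suc i) \<or> le (zs ! Suc i) (zs ! i)"
    using assms by (auto simp: comparable_chain_def)
  have in_M: "zs ! i \<in> M" if "i < length zs" for i
    using that zs by auto
  have x: "x \<in> M" using zs by auto
  \<comment> \<open>Stating the claim for every entry of the chain permits induction on the
    position; each link adds one null sequence through the triangle inequality.\<close>
  have "(\<lambda>n. d ((T ^^ n) x) ((T ^^ n) (zs ! i))) \<longlonglongrightarrow> 0" if "i < length zs" for i
    using that
  proof (induction i)
    case 0
    then show ?case using zs x funpow_closed by (simp add: hd_conv_nth)
  next
    case (Suc i)
    let ?u = "\<lambda>n. d ((T ^^ n) x) ((T ^^ n) (zs ! i))"
    let ?v = "\<lambda>n. d ((T ^^ n) (zs ! i)) ((T ^^ n) (zs ! Suc i))"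
    have "(\<lambda>n. ?u n + ?v n) \<longlonglongrightarrow> 0"
      using Suc comparable_orbits_asymptotic[OF in_M in_M comp]
      by (intro tendsto_add_zero) auto
    moreover have "d ((T ^^ n) x) ((T ^^ n) (zs ! Suc i)) \<le> ?u n + ?v n" for n
      using Suc.prems x in_M by (intro triangle funpow_closed) auto
    ultimately show ?case
      by (rule dist_null_comparison)
  qed
  from this[of "length zs - 1"] show ?thesis
    using zs by (simp add: last_conv_nth)
qed

text \<open>A progressive point supplies one fixed point \<open>z\<close>. A chain from any
  \<open>x\<close> to \<open>z\<close> then makes the orbit of \<open>x\<close> asymptotic to the
  constant orbit of \<open>z\<close>.\<close>

lemma strong_picard:
  assumes picard: "picard_operator le T" and "progressive_points le T \<noteq> {}"
    and chains: "\<And>x y. x \<in> M \<Longrightarrow> y \<in> M \<Longrightarrow> \<exists>zs. comparable_chain le x y zs"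
  shows "strong_picard_operator T"
proof -
  obtain z where z: "z \<in> fixed_points T"
    using assms(1,2) unfolding picard_operator_def by blast
  have funpow_fixed: "(T ^^ n) w = w" if "w \<in> fixed_points T" for n w
    using that by (induction n) (auto simp: fixed_points_def)
  have z_M: "z \<in> M" using z by (simp add: fixed_points_def)
  have attract: "(\<lambda>n. d ((T ^^ n) x) z) \<longlonglongrightarrow> 0" if "x \<in> M" for x
    using chain_orbits_asymptotic chains[OF that z_M] funpow_fixed[OF z] by fastforce
  then have "\<forall>x\<in>M. limitin mtopology (\<lambda>n. (T ^^ n) x) z sequentially"
    using z_M funpow_closed by (simp add: limitin_metric_dist_null)
  \<comment> \<open>The orbit of a fixed point \<open>w\<close> is constant, so its attraction to
    \<open>z\<close> makes the constant sequence \<open>d w z\<close> tend to 0.\<close>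
  moreover have "w = z" if w: "w \<in> fixed_points T" for w
  proof -
    have w_M: "w \<in> M" using w by (simp add: fixed_points_def)
    have "(\<lambda>n. d w z) \<longlonglongrightarrow> 0"
      using attract[OF w_M] funpow_fixed[OF w] by simp
    then show ?thesis using w_M z_M by (simp add: tendsto_const_iff)
  qed
  ultimately show ?thesis
    using z unfolding strong_picard_operator_def is_singleton_def by blast
qed

end

theorem theorem2:
  fixes X :: "'a set" and d :: "'a \<Rightarrow> 'a \<Rightarrow> real" and le :: "'a \<Rightarrow> 'a \<Rightarrow> bool"
    and T :: "'a \<Rightarrow> 'a" and \<alpha> :: real
  assumes "Metric_space X d"
    and "reflp_on X le" and "transp_on X le"
    and "T \<in> X \<rightarrow> X"
    and "Metric_space.progressive_points X le T \<noteq> {}"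
    and "monotone_on X le le T"
    and "Metric_space.order_complete X d le"
    and "0 < \<alpha>" and "\<alpha> < 1"
    and "\<And>x y. x \<in> X \<Longrightarrow> y \<in> X \<Longrightarrow> le x y \<Longrightarrow> d (T x) (T y) \<le> \<alpha> * d x y"
    and "Metric_space.order_continuous X d le T \<or> Metric_space.self_closed X d le"
  shows "Metric_space.picard_operator X d le T \<and>
    ((\<forall>x \<in> X. \<forall>y \<in> X. \<exists>zs. Metric_space.comparable_chain X le x y zs) \<longrightarrow>
       Metric_space.strong_picard_operator X d T)"
proof -
  interpret order_contraction X d le T \<alpha>
    using assms by (simp add: order_contraction_def order_contraction_axioms_def)
  have "picard_operator le T"
    using picard self_closed_imp_order_continuous assms(7,11) by blast
  then show ?thesis
    using strong_picard assms(5) by blast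
qed

end
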